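(* Let the spatial semi-discrete schemes for both (i) the evolved geometric moments $\mathcal M_{s,r}^{\mathrm{evo}}$ and (ii) the total conserved variables $\mathbf U^{\mathrm{tot}}$, with spatial operators $\mathcal L$ given in the context, be advanced by the forward Euler method $$(\cdot)^{n+1}=(\cdot)^n+\Delta t\,\mathcal L\bigl((\cdot)^n\bigr).$$ If at time $t^n$ every cell average $$\overline{\mathbf U}_h^n=\frac{\mathbf U_h^{\mathrm{tot},n}}{\mathcal M_{0,0}^{\mathrm{evo},n}}\in\mathcal G(\mathbf v^*,p^*;\gamma_h,B_h),$$ then after the forward Euler step each updated cell average preserves the pressure equilibrium: $$\overline{\mathbf U}_h^{n+1}=\frac{\mathbf U_h^{\mathrm{tot},n+1}}{\mathcal M_{0,0}^{\mathrm{evo},n+1}}\in\mathcal G(\mathbf v^*,p^*;\gamma_h,B_h).$$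
   Context: Equations. Two-dimensional compressible Euler equations $\partial_t\mathbf U+\nabla\cdot\mathbf F(\mathbf U)=0$ with two materials: $\mathbf U=(\rho,\rho\mathbf v^\top,E)^\top$, $\mathbf F(\mathbf U)=(\rho\mathbf v,\ \rho\mathbf v\otimes\mathbf v+p\mathbf I,\ (E+p)\mathbf v)^\top$, $E=\rho e+\frac12\rho|\mathbf v|^2$, $p=(\gamma-1)\rho e-\gamma B$, with $\gamma>1$, $B\ge0$ constant in each material. Equilibrium set: $\mathcal G(\mathbf v^*,p^*;\gamma,B)=\{(\rho,(\rho\mathbf v^* )^\top,\frac{p^*+\gamma B}{\gamma-1}+\frac12\rho|\mathbf v^*|^2)^\top:\rho>0\}$. Mesh. A piecewise linear numerical interface $\Gamma_h$ cuts the cells of a uniform Cartesian grid into polygonal single-material cut cells; undersized cut cells are merged with a neighbour of the same material. The control volumes are the merged cells $\tilde I$ and the fixed Cartesian cells (treated identically, as cells without interface edges). The boundary of $\tilde I$ consists of Cartesian-edge segments $e_{C,1},\dots,e_{C,N_C}$ (fixed or moving strictly tangentially) and interface-edge segments $e_{I,1},\dots,e_{I,N_I}$ (moving with the interface). $(\gamma_h,B_h)$ are the numerical equation-of-state parameters of the cell. Each cell carries $\mathbf U_h^{\mathrm{tot}}$, the numerical value of $\mathbf U^{\mathrm{tot}}=\int\mathbf U\,\mathrm dx\,\mathrm dy$, and evolved geometric moments $\mathcal M_{s,r}^{\mathrm{evo}}$, the values of $\int x^sy^r\,\mathrm dx\,\mathrm dy$ obtained by evolving with the operator below. Quadrature.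 Two Gauss points $\mathbf x_{C,\alpha}^{(k)}$, resp. $\mathbf x_{I,\beta}^{(\ell)}=(x_{I,\beta}^{(\ell)},y_{I,\beta}^{(\ell)})$, are placed on each segment; $\omega(\cdot)$ is the Gaussian weight (normalized so that weights on a segment sum to 1), $|e(\mathbf x)|$ the length of the segment containing $\mathbf x$, $\mathbf n$ the outward unit normal. Reconstruction. A reconstruction from $\mathbf U_h^{\mathrm{tot}}$ and $\mathcal M_{s,r}^{\mathrm{evo}}$ of neighbouring cells (of the same material) gives at each Gauss point the values $\mathbf U^{\mathrm{int}}$ (from the interior of $\tilde I$) and $\mathbf U^{\mathrm{ext}}$ (from the exterior). It is equilibrium-compatible (EC): whenever all cell averages $\mathbf U^{\mathrm{tot}}/\mathcal M_{0,0}$ in the reconstruction stencil share a uniform velocity $\mathbf v^*$ and pressure $p^*$, the reconstructed point values reproduce exactly $\mathbf v^*$ and $p^*$. Fluxes. On Cartesian edges, the local Lax–Friedrichs flux $\widehat{\mathbf F}^{\mathrm{single}}(\mathbf U^{\mathrm{int}},\mathbf U^{\mathrm{ext}})=\frac12[\mathbf F(\mathbf U^{\mathrm{int}})\cdot\mathbf n+\mathbf F(\mathbf U^{\mathrm{ext}})\cdot\mathbf n-a_{\max}(\mathbf U^{\mathrm{ext}}-\mathbf U^{\mathrm{int}})]$, $a_{\max}$ being the local maximum spectral radius of $\partial(\mathbf F\cdot\mathbf n)/\partial\mathbf U$. On interface edges, $\widehat{\mathbf F}^{\mathrm{multi}}(\mathbf U^{\mathrm{int}},\mathbf U^{\mathrm{ext}})=(0,\,p\,\mathbf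 n^\top,\,p\,v_\perp)^\top$, where $(p,v_\perp)$ are the pressure and normal velocity obtained from a multi-material Riemann solver applied to $(\mathbf U^{\mathrm{int}},\mathbf U^{\mathrm{ext}})$; the solver is required to return $p=p^*$, $v_\perp=v_\perp^*$ if both states share the pressure $p^*$ and normal velocity $v_\perp^*$. Operators. $$\mathcal L(\mathcal M_{s,r}^{\mathrm{evo}})=\sum_{\beta=1}^{N_I}\sum_{\ell=1}^2(x_{I,\beta}^{(\ell)})^s(y_{I,\beta}^{(\ell)})^r|e(\mathbf x_{I,\beta}^{(\ell)})|\,\omega(\mathbf x_{I,\beta}^{(\ell)})\,v_\perp(\mathbf x_{I,\beta}^{(\ell)}),$$ $$\mathcal L(\mathbf U_h^{\mathrm{tot}})=-\sum_{\alpha=1}^{N_C}\sum_{k=1}^2|e(\mathbf x_{C,\alpha}^{(k)})|\omega(\mathbf x_{C,\alpha}^{(k)})\widehat{\mathbf F}^{\mathrm{single}}(\mathbf U^{\mathrm{int}}_{C,\alpha,k},\mathbf U^{\mathrm{ext}}_{C,\alpha,k})-\sum_{\beta=1}^{N_I}\sum_{\ell=1}^2|e(\mathbf x_{I,\beta}^{(\ell)})|\omega(\mathbf x_{I,\beta}^{(\ell)})\widehat{\mathbf F}^{\mathrm{multi}}(\mathbf U^{\mathrm{int}}_{I,\beta,\ell},\mathbf U^{\mathrm{ext}}_{I,\beta,\ell}),$$ where $v_\perp(\mathbf x_{I,\beta}^{(\ell)})$ is the normal velocity given by the Riemann solver at that Gauss point.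
   Formalization: For large time steps the updated density or M_{0,0} can fail to be positive, so the result is stated for cells whose updated M_{0,0} and updated average density are positive; M_{0,0} and the reconstructed point densities at time t^n are also assumed positive. *)

theory Defs
  imports "HOL-Analysis.Analysis"
begin

section \<open>Euler equations with stiffened-gas materials\<close>

type_synonym point = "real^2"
type_synonym state = "real^4"  \<comment> \<open>\<open>(\<rho>, \<rho> v\<^sub>1, \<rho> v\<^sub>2, E)\<close>\<close>

datatype material = Mat1 | Mat2

record eos =
  gam :: real
  Bc :: real

definition conserved :: "real \<Rightarrow> real^2 \<Rightarrow> real \<Rightarrow> state" where
  "conserved \<rho> m E = vector [\<rho>, m $ 1, m $ 2, E]"

definition mass_density :: "state \<Rightarrow> real" where
  "mass_density U = U $ 1"

definition momentum :: "state \<Rightarrow> real^2" where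
  "momentum U = vector [U $ 2, U $ 3]"

definition energy :: "state \<Rightarrow> real" where
  "energy U = U $ 4"

definition velocity :: "state \<Rightarrow> real^2" where
  "velocity U = momentum U /\<^sub>R mass_density U"

text \<open>\<open>\<rho> e\<close>, from \<open>E = \<rho> e + \<rho> |v|\<^sup>2 / 2\<close>.\<close>

definition internal_energy :: "state \<Rightarrow> real" where
  "internal_energy U = energy U - 1/2 * mass_density U * (norm (velocity U))\<^sup>2"

definition pressure :: "eos \<Rightarrow> state \<Rightarrow> real" where
  "pressure q U = (gam q - 1) * internal_energy U - gam q * Bc q"

text \<open>The rows of the flux matrix are indexed by the conserved components, so that
  \<open>F(U) \<cdot> n\<close> is the matrix-vector product \<open>euler_flux q U *v n\<close>.\<close>

definition euler_flux :: "eos \<Rightarrow> state \<Rightarrow> real^2^4" where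
  "euler_flux q U =
     (let \<rho> = mass_density U; v = velocity U; p = pressure q U
      in vector [\<rho> *\<^sub>R v,
                 (\<rho> * v $ 1) *\<^sub>R v + p *\<^sub>R axis 1 1,
                 (\<rho> * v $ 2) *\<^sub>R v + p *\<^sub>R axis 2 1,
                 (energy U + p) *\<^sub>R v])"

definition equilibrium_set :: "real^2 \<Rightarrow> real \<Rightarrow> eos \<Rightarrow> state set" where
  "equilibrium_set v p q =
     {conserved \<rho> (\<rho> *\<^sub>R v)
        ((p + gam q * Bc q) / (gam q - 1) + 1/2 * \<rho> * (norm v)\<^sup>2) | \<rho>. 0 < \<rho>}"


section \<open>Mesh\<close>

datatype edge_kind = Cartesian | Interface

text \<open>A boundary segment of a control volume, directed so that the control volume lies on
  its left, together with the cell on its other side.\<close>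

datatype 'c segment =
  Segment (seg_start: point) (seg_end: point) (kind: edge_kind) (nbr: 'c)

definition seg_closed :: "'c segment \<Rightarrow> point set" where
  "seg_closed e = closed_segment (seg_start e) (seg_end e)"

definition seg_open :: "'c segment \<Rightarrow> point set" where
  "seg_open e = open_segment (seg_start e) (seg_end e)"

definition seg_length :: "'c segment \<Rightarrow> real" where
  "seg_length e = dist (seg_start e) (seg_end e)"

text \<open>The unit tangent rotated clockwise by a right angle; that it points out of the control
  volume is part of \<open>polygonal_cell\<close>.\<close>

definition seg_normal :: "'c segment \<Rightarrow> real^2" where
  "seg_normal e =
     (let d = seg_end e - seg_start e in vector [d $ 2, - d $ 1] /\<^sub>R seg_length e)"

text \<open>The two-point Gauss rule: nodes \<open>\<plusminus>1/\<surd>3\<close> on \<open>[-1,1]\<close> with equal weights, transported to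
  the segment; the weights are normalized to sum to 1.\<close>

definition gauss_point :: "'c segment \<Rightarrow> nat \<Rightarrow> point" where
  "gauss_point e k =
     (1/2) *\<^sub>R (seg_start e + seg_end e)
     + ((if k = 1 then -1 else 1) / (2 * sqrt 3)) *\<^sub>R (seg_end e - seg_start e)"

definition gauss_weight :: "nat \<Rightarrow> real" where
  "gauss_weight k = 1/2"

text \<open>\<open>cvs\<close> is the set of control volumes that are evolved. The remaining elements of the index
  type \<open>'c\<close> are ghost cells, which carry data but are not evolved; they supply exterior values
  where a control volume touches the boundary of the computational domain. For a mesh without
  boundary, \<open>cvs = UNIV\<close>. The boundary of a control volume may consist of several closed
  loops. \<open>iface\<close> lists the pieces of the piecewise linear interface, as pairs of end points.\<close>

record 'c mesh =
  grid_origin :: point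
  grid_size :: "real^2"
  iface :: "(point \<times> point) set"
  cvs :: "'c set"
  material_of :: "'c \<Rightarrow> material"
  region :: "'c \<Rightarrow> point set"
  loops :: "'c \<Rightarrow> 'c segment list list"

definition interface :: "'c mesh \<Rightarrow> point set" where
  "interface m = (\<Union>(a, b) \<in> iface m. closed_segment a b)"

definition segments :: "'c mesh \<Rightarrow> 'c \<Rightarrow> 'c segment list" where
  "segments m c = concat (loops m c)"

definition cart_segments :: "'c mesh \<Rightarrow> 'c \<Rightarrow> 'c segment list" where
  "cart_segments m c = filter (\<lambda>e. kind e = Cartesian) (segments m c)"

definition iface_segments :: "'c mesh \<Rightarrow> 'c \<Rightarrow> 'c segment list" where
  "iface_segments m c = filter (\<lambda>e. kind e = Interface) (segments m c)"

definition closed_loop :: "'c segment list \<Rightarrow> bool" where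
  "closed_loop es \<longleftrightarrow> es \<noteq> [] \<and> map seg_end es = rotate1 (map seg_start es)"

definition polygonal_cell :: "point set \<Rightarrow> 'c segment list list \<Rightarrow> bool" where
  "polygonal_cell K ls \<longleftrightarrow>
     compact K \<and> interior K \<noteq> {} \<and> K = closure (interior K) \<and>
     (\<forall>es \<in> set ls. closed_loop es) \<and>
     frontier K = (\<Union>e \<in> set (concat ls). seg_closed e) \<and>
     distinct (concat ls) \<and>
     (\<forall>e \<in> set (concat ls). seg_start e \<noteq> seg_end e) \<and>
     (\<forall>e \<in> set (concat ls). \<forall>e' \<in> set (concat ls). e \<noteq> e' \<longrightarrow> seg_open e \<inter> seg_open e' = {}) \<and>
     (\<forall>e \<in> set (concat ls). \<forall>x \<in> seg_open e.
        eventually (\<lambda>\<epsilon>. x + \<epsilon> *\<^sub>R seg_normal e \<notin> K \<and> x - \<epsilon> *\<^sub>R seg_normal e \<in> K) (at_right 0))"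

definition on_grid_line :: "'c mesh \<Rightarrow> 'c segment \<Rightarrow> bool" where
  "on_grid_line m e \<longleftrightarrow>
     (\<exists>i. \<exists>j::int. seg_start e $ i = grid_origin m $ i + of_int j * grid_size m $ i
                 \<and> seg_end e $ i = seg_start e $ i)"

text \<open>Since the interior of a control volume avoids the interface and its boundary lies on grid
  lines and on the interface, each control volume is a union of cut cells (or uncut Cartesian
  cells), of a single material: the result of an arbitrary merging of such cells.\<close>

definition cut_cell_mesh :: "'c mesh \<Rightarrow> bool" where
  "cut_cell_mesh m \<longleftrightarrow>
     (\<forall>i. 0 < grid_size m $ i) \<and>
     (\<forall>r. finite {(a, b). (a, b) \<in> iface m \<and> closed_segment a b \<inter> cball 0 r \<noteq> {}}) \<and>
     (\<forall>c \<in> cvs m. polygonal_cell (region m c) (loops m c)) \<and>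
     (\<forall>c \<in> cvs m. interior (region m c) \<inter> interface m = {}) \<and>
     (\<forall>c \<in> cvs m. \<forall>d \<in> cvs m. c \<noteq> d \<longrightarrow> interior (region m c) \<inter> interior (region m d) = {}) \<and>
     (\<forall>c \<in> cvs m. \<forall>e \<in> set (cart_segments m c).
        on_grid_line m e \<and> material_of m (nbr e) = material_of m c) \<and>
     (\<forall>c \<in> cvs m. \<forall>e \<in> set (iface_segments m c).
        seg_closed e \<subseteq> interface m \<and> material_of m (nbr e) \<noteq> material_of m c) \<and>
     (\<forall>c \<in> cvs m. \<forall>e \<in> set (segments m c). nbr e \<in> cvs m \<longrightarrow>
        Segment (seg_end e) (seg_start e) (kind e) c \<in> set (segments m (nbr e)))"


section \<open>Reconstruction\<close>

type_synonym 'c totals = "'c \<Rightarrow> state"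
type_synonym 'c moments = "'c \<Rightarrow> nat \<Rightarrow> nat \<Rightarrow> real"  \<comment> \<open>\<open>M c s r\<close> for \<open>\<integral> x\<^sup>s y\<^sup>r\<close>\<close>

text \<open>\<open>R U M c x\<close> is the value at the point \<open>x\<close> of the reconstruction belonging to the cell \<open>c\<close>.\<close>

type_synonym 'c reconstruction = "'c totals \<Rightarrow> 'c moments \<Rightarrow> 'c \<Rightarrow> point \<Rightarrow> state"

definition average :: "'c totals \<Rightarrow> 'c moments \<Rightarrow> 'c \<Rightarrow> state" where
  "average U M c = U c /\<^sub>R M c 0 0"

definition U_int ::
  "'c reconstruction \<Rightarrow> 'c totals \<Rightarrow> 'c moments \<Rightarrow> 'c \<Rightarrow> 'c segment \<Rightarrow> nat \<Rightarrow> state" where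
  "U_int R U M c e k = R U M c (gauss_point e k)"

definition U_ext ::
  "'c reconstruction \<Rightarrow> 'c totals \<Rightarrow> 'c moments \<Rightarrow> 'c segment \<Rightarrow> nat \<Rightarrow> state" where
  "U_ext R U M e k = R U M (nbr e) (gauss_point e k)"

text \<open>The pairs of a cell and a Gauss point at which the scheme evaluates the reconstruction
  of that cell, from the interior or from the exterior of some control volume.\<close>

definition trace_points :: "'c mesh \<Rightarrow> ('c \<times> point) set" where
  "trace_points m =
     {(d, gauss_point e k) | c d e k.
        c \<in> cvs m \<and> e \<in> set (segments m c) \<and> k \<in> {1, 2} \<and> (d = c \<or> d = nbr e)}"

definition single_material_stencils ::
  "'c mesh \<Rightarrow> ('c \<Rightarrow> 'c set) \<Rightarrow> 'c reconstruction \<Rightarrow> bool" where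
  "single_material_stencils m S R \<longleftrightarrow>
     (\<forall>c. \<forall>d \<in> S c. material_of m d = material_of m c) \<and>
     (\<forall>U U' M M' c. (\<forall>d \<in> S c. U d = U' d \<and> M d = M' d) \<longrightarrow> R U M c = R U' M' c)"

text \<open>Reproduction of \<open>v\<close> and \<open>p\<close> is demanded only for data with positive cell sizes and
  densities and at points where the reconstructed density is positive: elsewhere velocity and
  pressure have no meaning (and division by zero yields 0).\<close>

definition equilibrium_compatible ::
  "(material \<Rightarrow> eos) \<Rightarrow> 'c mesh \<Rightarrow> ('c \<Rightarrow> 'c set) \<Rightarrow> 'c reconstruction \<Rightarrow> bool" where
  "equilibrium_compatible q m S R \<longleftrightarrow>
     (\<forall>U M v p. \<forall>(c, x) \<in> trace_points m.
        (\<forall>d \<in> S c. 0 < M d 0 0 \<and> 0 < mass_density (average U M d) \<and>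
                    velocity (average U M d) = v \<and>
                    pressure (q (material_of m d)) (average U M d) = p) \<longrightarrow>
        0 < mass_density (R U M c x) \<longrightarrow>
        velocity (R U M c x) = v \<and> pressure (q (material_of m c)) (R U M c x) = p)"


section \<open>Numerical fluxes\<close>

definition spectral_radius :: "real^'n^'n \<Rightarrow> real" where
  "spectral_radius A =
     Max {cmod z | z. \<exists>w::complex^'n. w \<noteq> 0 \<and> (\<chi> i j. complex_of_real (A $ i $ j)) *v w = z *s w}"

definition a_max :: "eos \<Rightarrow> real^2 \<Rightarrow> state \<Rightarrow> state \<Rightarrow> real" where
  "a_max q n Ui Ue =
     max (spectral_radius (jacobian (\<lambda>U. euler_flux q U *v n) (at Ui)))
         (spectral_radius (jacobian (\<lambda>U. euler_flux q U *v n) (at Ue)))"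

definition flux_single :: "eos \<Rightarrow> real^2 \<Rightarrow> state \<Rightarrow> state \<Rightarrow> state" where
  "flux_single q n Ui Ue =
     (1/2) *\<^sub>R (euler_flux q Ui *v n + euler_flux q Ue *v n - a_max q n Ui Ue *\<^sub>R (Ue - Ui))"

text \<open>\<open>rs qi qe n Ui Ue\<close> is the pair of pressure and velocity in direction \<open>n\<close> returned by the
  Riemann solver for an interior state of material \<open>qi\<close> and an exterior one of material \<open>qe\<close>.\<close>

type_synonym riemann_solver = "eos \<Rightarrow> eos \<Rightarrow> real^2 \<Rightarrow> state \<Rightarrow> state \<Rightarrow> real \<times> real"

definition equilibrium_exact :: "(material \<Rightarrow> eos) \<Rightarrow> riemann_solver \<Rightarrow> bool" where
  "equilibrium_exact q rs \<longleftrightarrow>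
     (\<forall>a b n Ui Ue p w.
        norm n = 1 \<and> 0 < mass_density Ui \<and> 0 < mass_density Ue \<and>
        pressure (q a) Ui = p \<and> pressure (q b) Ue = p \<and>
        velocity Ui \<bullet> n = w \<and> velocity Ue \<bullet> n = w \<longrightarrow>
        rs (q a) (q b) n Ui Ue = (p, w))"

definition flux_multi :: "riemann_solver \<Rightarrow> eos \<Rightarrow> eos \<Rightarrow> real^2 \<Rightarrow> state \<Rightarrow> state \<Rightarrow> state" where
  "flux_multi rs qi qe n Ui Ue =
     (case rs qi qe n Ui Ue of (p, w) \<Rightarrow> conserved 0 (p *\<^sub>R n) (p * w))"


section \<open>Spatial operators\<close>

definition v_perp ::
  "(material \<Rightarrow> eos) \<Rightarrow> 'c mesh \<Rightarrow> 'c reconstruction \<Rightarrow> riemann_solver \<Rightarrow>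
   'c totals \<Rightarrow> 'c moments \<Rightarrow> 'c \<Rightarrow> 'c segment \<Rightarrow> nat \<Rightarrow> real" where
  "v_perp q m R rs U M c e k =
     snd (rs (q (material_of m c)) (q (material_of m (nbr e))) (seg_normal e)
             (U_int R U M c e k) (U_ext R U M e k))"

definition moment_op ::
  "(material \<Rightarrow> eos) \<Rightarrow> 'c mesh \<Rightarrow> 'c reconstruction \<Rightarrow> riemann_solver \<Rightarrow>
   'c totals \<Rightarrow> 'c moments \<Rightarrow> 'c \<Rightarrow> nat \<Rightarrow> nat \<Rightarrow> real" where
  "moment_op q m R rs U M c s r =
     (\<Sum>e\<leftarrow>iface_segments m c. \<Sum>k\<in>{1, 2}.
        (gauss_point e k $ 1) ^ s * (gauss_point e k $ 2) ^ r
        * seg_length e * gauss_weight k * v_perp q m R rs U M c e k)"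

definition total_op ::
  "(material \<Rightarrow> eos) \<Rightarrow> 'c mesh \<Rightarrow> 'c reconstruction \<Rightarrow> riemann_solver \<Rightarrow>
   'c totals \<Rightarrow> 'c moments \<Rightarrow> 'c \<Rightarrow> state" where
  "total_op q m R rs U M c =
     - (\<Sum>e\<leftarrow>cart_segments m c. \<Sum>k\<in>{1, 2}.
          (seg_length e * gauss_weight k) *\<^sub>R
            flux_single (q (material_of m c)) (seg_normal e)
              (U_int R U M c e k) (U_ext R U M e k))
     - (\<Sum>e\<leftarrow>iface_segments m c. \<Sum>k\<in>{1, 2}.
          (seg_length e * gauss_weight k) *\<^sub>R
            flux_multi rs (q (material_of m c)) (q (material_of m (nbr e))) (seg_normal e)
              (U_int R U M c e k) (U_ext R U M e k))"

end

theory Submission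
  imports Defs
begin

text \<open>At fixed velocity \<open>v\<close> and pressure \<open>p\<close>, the equilibrium states of one material form a ray
  \<open>\<rho> a + b\<close>, where \<open>a = (1, v, |v|\<^sup>2/2)\<close> and \<open>b\<close> is the constant internal energy density.
  On it \<open>F(U) \<cdot> n = (v \<cdot> n) U + p (0, n, v \<cdot> n)\<close>, so modulo multiples of \<open>a\<close> (which absorb the
  dissipation as well) the single-material flux is \<open>(v \<cdot> n) b + p (0, n, v \<cdot> n)\<close>, while the
  interface flux is \<open>p (0, n, v \<cdot> n)\<close>. Since \<open>\<Sum> |e| n = 0\<close> over the closed boundary, all pressure
  terms cancel, and the sum of \<open>(v \<cdot> n) b\<close> over the Cartesian edges is minus that over the
  interface edges. The update of \<open>U\<close> is therefore \<open>b\<close> times the update of \<open>M\<^sub>0\<^sub>0\<close>, modulo \<open>a\<close>.\<close>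

section \<open>Components of states and membership in the equilibrium set\<close>

lemma vector_4 [simp]:
  "(vector [a, b, c, d] :: 'a::zero^4) $ 1 = a" "(vector [a, b, c, d] :: 'a::zero^4) $ 2 = b"
  "(vector [a, b, c, d] :: 'a::zero^4) $ 3 = c" "(vector [a, b, c, d] :: 'a::zero^4) $ 4 = d"
  unfolding vector_def by simp_all

lemma conserved_nth [simp]:
  "conserved \<rho> m E $ 1 = \<rho>" "conserved \<rho> m E $ 2 = m $ 1"
  "conserved \<rho> m E $ 3 = m $ 2" "conserved \<rho> m E $ 4 = E"
  by (simp_all add: conserved_def)

lemma mass_density_conserved [simp]: "mass_density (conserved \<rho> m E) = \<rho>"
  by (simp add: mass_density_def)

lemma momentum_conserved [simp]: "momentum (conserved \<rho> m E) = m"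
  by (simp add: momentum_def vec_eq_iff forall_2)

lemma energy_conserved [simp]: "energy (conserved \<rho> m E) = E"
  by (simp add: energy_def)

lemma conserved_collapse: "conserved (mass_density U) (momentum U) (energy U) = U"
  by (simp add: vec_eq_iff forall_4 mass_density_def momentum_def energy_def)

text \<open>Positive density lets the velocity determine the momentum, and \<open>gam q > 1\<close>
  lets the pressure determine the internal energy, so only the density remains free.\<close>

lemma mem_equilibrium_set_iff:
  assumes "1 < gam q"
  shows "U \<in> equilibrium_set v p q \<longleftrightarrow>
           0 < mass_density U \<and> velocity U = v \<and> pressure q U = p"
    (is "?lhs \<longleftrightarrow> ?rhs")
proof
  assume ?lhs
  then obtain \<rho> where "0 < \<rho>" and
    U: "U = conserved \<rho> (\<rho> *\<^sub>R v) ((p + gam q * Bc q) / (gam q - 1) + 1/2 * \<rho> * (norm v)\<^sup>2)"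
    by (auto simp: equilibrium_set_def)
  moreover from this have "velocity U = v"
    by (simp add: velocity_def)
  ultimately show ?rhs
    using assms by (simp add: pressure_def internal_energy_def)
next
  assume rhs: ?rhs
  have "momentum U = mass_density U *\<^sub>R v"
    using rhs by (auto simp: velocity_def)
  moreover have "energy U = (p + gam q * Bc q) / (gam q - 1) + 1/2 * mass_density U * (norm v)\<^sup>2"
    using rhs assms by (auto simp: pressure_def internal_energy_def field_simps)
  ultimately have "U = conserved (mass_density U) (mass_density U *\<^sub>R v)
      ((p + gam q * Bc q) / (gam q - 1) + 1/2 * mass_density U * (norm v)\<^sup>2)"
    using conserved_collapse[of U] by simp
  with rhs show ?lhs
    unfolding equilibrium_set_def by blast
qed

section \<open>The equilibrium ray and the fluxes on it\<close>

definition advected :: "real^2 \<Rightarrow> state" where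
  "advected v = conserved 1 v (1/2 * (norm v)\<^sup>2)"

definition internal :: "real \<Rightarrow> eos \<Rightarrow> state" where
  "internal p q = conserved 0 0 ((p + gam q * Bc q) / (gam q - 1))"

text \<open>The vector \<open>n\<close> need not have unit length: being linear in \<open>n\<close>,
  this can be evaluated at length-scaled normals and summed over a boundary.\<close>

definition pressure_flux :: "real^2 \<Rightarrow> real^2 \<Rightarrow> state" where
  "pressure_flux v n = conserved 0 n (v \<bullet> n)"

lemma equilibrium_set_eq_ray:
  "equilibrium_set v p q = {\<rho> *\<^sub>R advected v + internal p q | \<rho>. 0 < \<rho>}"
proof -
  have "conserved \<rho> (\<rho> *\<^sub>R v) ((p + gam q * Bc q) / (gam q - 1) + 1/2 * \<rho> * (norm v)\<^sup>2)
      = \<rho> *\<^sub>R advected v + internal p q" for \<rho>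
    by (simp add: vec_eq_iff forall_4 advected_def internal_def)
  then show ?thesis
    by (simp add: equilibrium_set_def)
qed

lemma linear_pressure_flux: "linear (pressure_flux v)"
  by (rule linearI)
     (simp_all add: pressure_flux_def vec_eq_iff forall_4 inner_add_right)

lemma euler_flux_equilibrium:
  assumes "velocity U = v" "pressure q U = p" "0 < mass_density U"
  shows "euler_flux q U *v n = (v \<bullet> n) *\<^sub>R U + p *\<^sub>R pressure_flux v n"
proof -
  \<comment> \<open>\<open>velocity\<close> divides by the density, whose positivity therefore
    allows the momentum to be recovered.\<close>
  have "momentum U = mass_density U *\<^sub>R v"
    using assms by (auto simp: velocity_def)
  then have "U $ 2 = U $ 1 * v $ 1" "U $ 3 = U $ 1 * v $ 2"
    by (simp_all add: momentum_def mass_density_def vec_eq_iff forall_2)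
  then show ?thesis
    using assms
    by (simp add: vec_eq_iff forall_4 euler_flux_def Let_def matrix_vector_mult_def sum_2
        mass_density_def energy_def pressure_flux_def inner_vec_def axis_def algebra_simps)
qed

text \<open>Both states lie on one ray, so the jump \<open>Ue - Ui\<close> in the dissipation is a
  multiple of \<open>advected v\<close>, and so is the excess of the mean of the two exact fluxes
  over the subtracted term.\<close>

lemma flux_single_equilibrium:
  assumes "1 < gam q" "Ui \<in> equilibrium_set v p q" "Ue \<in> equilibrium_set v p q"
  shows "flux_single q n Ui Ue - ((v \<bullet> n) *\<^sub>R internal p q + p *\<^sub>R pressure_flux v n)
           \<in> span {advected v}"
proof -
  obtain \<rho>i \<rho>e where
    U: "Ui = \<rho>i *\<^sub>R advected v + internal p q" "Ue = \<rho>e *\<^sub>R advected v + internal p q"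
    using assms(2,3) by (auto simp: equilibrium_set_eq_ray)
  have "euler_flux q Ui *v n = (v \<bullet> n) *\<^sub>R Ui + p *\<^sub>R pressure_flux v n"
       "euler_flux q Ue *v n = (v \<bullet> n) *\<^sub>R Ue + p *\<^sub>R pressure_flux v n"
    using assms by (simp_all add: euler_flux_equilibrium mem_equilibrium_set_iff)
  then have "flux_single q n Ui Ue - ((v \<bullet> n) *\<^sub>R internal p q + p *\<^sub>R pressure_flux v n)
      = ((v \<bullet> n) * (\<rho>i + \<rho>e) / 2 - a_max q n Ui Ue * (\<rho>e - \<rho>i) / 2) *\<^sub>R advected v"
    unfolding flux_single_def
    by (simp add: U vec_eq_iff field_simps)
  then show ?thesis
    by (simp add: span_base span_mul)
qed

lemma flux_multi_equilibrium:
  assumes "rs qi qe n Ui Ue = (p, v \<bullet> n)"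
  shows "flux_multi rs qi qe n Ui Ue = p *\<^sub>R pressure_flux v n"
  using assms by (simp add: flux_multi_def pressure_flux_def vec_eq_iff forall_4)

section \<open>Length-scaled normals and closed boundaries\<close>

definition scaled_normal :: "'c segment \<Rightarrow> real^2" where
  "scaled_normal e = seg_length e *\<^sub>R seg_normal e"

text \<open>The length cancels the normalization, leaving the edge vector turned by a right angle,
  which is linear in the end points. For a degenerate segment both sides are 0.\<close>

lemma scaled_normal_eq:
  "scaled_normal e = vector [(seg_end e - seg_start e) $ 2, - (seg_end e - seg_start e) $ 1]"
proof (cases "seg_end e = seg_start e")
  case True
  then show ?thesis
    by (simp add: scaled_normal_def seg_length_def vec_eq_iff forall_2)
next
  case False
  then have "seg_length e \<noteq> 0"
    by (simp add: seg_length_def)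
  then show ?thesis
    by (simp add: scaled_normal_def seg_normal_def Let_def)
qed

lemma norm_seg_normal:
  assumes "seg_start e \<noteq> seg_end e"
  shows "norm (seg_normal e) = 1"
proof -
  have "norm (scaled_normal e) = seg_length e"
    by (simp add: scaled_normal_eq seg_length_def dist_vec_def norm_vec_def L2_set_def sum_2
        dist_real_def power2_commute add.commute)
  then show ?thesis
    using assms by (simp add: scaled_normal_def seg_length_def)
qed

lemma sum_list_linear:
  assumes "linear f"
  shows "(\<Sum>x\<leftarrow>xs. f (g x)) = f (\<Sum>x\<leftarrow>xs. g x)"
  by (induction xs) (simp_all add: linear_0[OF assms] linear_add[OF assms])

lemma sum_list_rotate1: "sum_list (rotate1 xs) = (sum_list xs :: 'a::comm_monoid_add)"
  by (cases xs) (simp_all add: add.commute)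

text \<open>The end points of a closed loop are its start points in rotated order, so the edge
  vectors sum to zero; turning by a right angle is linear and preserves this.\<close>

lemma sum_scaled_normal_closed_loop:
  assumes "closed_loop es"
  shows "(\<Sum>e\<leftarrow>es. scaled_normal e) = 0"
proof -
  let ?rot = "\<lambda>d::real^2. vector [d $ 2, - d $ 1] :: real^2"
  have "linear ?rot"
    by (rule linearI) (simp_all add: vec_eq_iff forall_2)
  moreover have "(\<Sum>e\<leftarrow>es. seg_end e - seg_start e) = 0"
    using assms by (simp add: sum_list_subtractf closed_loop_def sum_list_rotate1)
  ultimately show ?thesis
    using sum_list_linear[of ?rot "\<lambda>e. seg_end e - seg_start e" es] linear_0[of ?rot]
    by (simp only: scaled_normal_eq)
qed

lemma sum_scaled_normal_boundary:
  assumes "\<forall>es \<in> set ls. closed_loop es"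
  shows "(\<Sum>e\<leftarrow>concat ls. scaled_normal e) = 0"
  using assms by (induction ls) (simp_all add: sum_scaled_normal_closed_loop)

lemma sum_list_segments_split:
  fixes f :: "'c segment \<Rightarrow> 'a::comm_monoid_add"
  shows "(\<Sum>e\<leftarrow>segments m c. f e) = (\<Sum>e\<leftarrow>cart_segments m c. f e) + (\<Sum>e\<leftarrow>iface_segments m c. f e)"
proof -
  have "(\<Sum>e\<leftarrow>es. f e) =
      (\<Sum>e\<leftarrow>filter (\<lambda>e. kind e = Cartesian) es. f e) + (\<Sum>e\<leftarrow>filter (\<lambda>e. kind e = Interface) es. f e)"
    for es
  proof (induction es)
    case (Cons e es)
    then show ?case
      by (cases "kind e") (simp_all add: ac_simps)
  qed simp
  then show ?thesis
    unfolding cart_segments_def iface_segments_def .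
qed

lemma sum_list_in_subspace:
  assumes "subspace V" "\<And>x. x \<in> set xs \<Longrightarrow> f x \<in> V"
  shows "(\<Sum>x\<leftarrow>xs. f x) \<in> V"
  using assms(2) by (induction xs) (auto simp: subspace_0 subspace_add assms(1))

section \<open>Equilibrium of the traces and balance of the spatial operators\<close>

lemma reconstruction_equilibrium:
  assumes gam: "\<And>a. 1 < gam (q a)"
    and EC: "equilibrium_compatible q m S R"
    and size_pos: "\<And>c. 0 < M c 0 0"
    and equilibrium: "\<And>c. average U M c \<in> equilibrium_set v p (q (material_of m c))"
    and tp: "(c, x) \<in> trace_points m"
    and pos: "0 < mass_density (R U M c x)"
  shows "R U M c x \<in> equilibrium_set v p (q (material_of m c))"
proof -
  \<comment> \<open>Equilibrium is assumed in every cell, ghosts included, so it holds on any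
    stencil, each pressure being taken with the material of its own cell.\<close>
  have "\<forall>d \<in> S c. 0 < M d 0 0 \<and> 0 < mass_density (average U M d) \<and>
      velocity (average U M d) = v \<and> pressure (q (material_of m d)) (average U M d) = p"
    using equilibrium size_pos by (simp add: mem_equilibrium_set_iff gam)
  then show ?thesis
    using EC tp pos unfolding equilibrium_compatible_def mem_equilibrium_set_iff[OF gam] by blast
qed

text \<open>Working modulo \<open>advected v\<close> forgets only the density: what is left says
  that the \<open>internal\<close> part of the total grows at the same rate as the cell
  size.\<close>

lemma total_op_equilibrium:
  assumes gam: "\<And>a. 1 < gam (q a)"
    and riemann: "equilibrium_exact q rs"
    and loops: "\<forall>es \<in> set (loops m c). closed_loop es"
    and nondeg: "\<forall>e \<in> set (segments m c). seg_start e \<noteq> seg_end e"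
    and cart: "\<forall>e \<in> set (cart_segments m c). material_of m (nbr e) = material_of m c"
    and int: "\<And>e k. e \<in> set (segments m c) \<Longrightarrow> k \<in> {1, 2} \<Longrightarrow>
                U_int R U M c e k \<in> equilibrium_set v p (q (material_of m c))"
    and ext: "\<And>e k. e \<in> set (segments m c) \<Longrightarrow> k \<in> {1, 2} \<Longrightarrow>
                U_ext R U M e k \<in> equilibrium_set v p (q (material_of m (nbr e)))"
  shows "total_op q m R rs U M c
           - moment_op q m R rs U M c 0 0 *\<^sub>R internal p (q (material_of m c)) \<in> span {advected v}"
proof -
  let ?q = "q (material_of m c)"
  let ?b = "internal p ?q"
  let ?Fs = "\<lambda>e k. flux_single ?q (seg_normal e) (U_int R U M c e k) (U_ext R U M e k)"
  let ?C = "\<lambda>e. \<Sum>k\<in>{1, 2}. (seg_length e * gauss_weight k) *\<^sub>R ?Fs e k"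
  \<comment> \<open>The single-material flux modulo \<open>advected v\<close>, extended linearly to
    all normals. On interface edges it exceeds the actual flux by the \<open>?b\<close> term
    alone.\<close>
  let ?g = "\<lambda>d. (v \<bullet> d) *\<^sub>R ?b + p *\<^sub>R pressure_flux v d"
  have g: "linear ?g"
    by (rule linearI)
       (simp_all add: linear_add[OF linear_pressure_flux] linear_scale[OF linear_pressure_flux]
          inner_add_right algebra_simps)
  have P: "linear (\<lambda>d. p *\<^sub>R pressure_flux v d)"
    by (intro linear_compose_scale_right linear_pressure_flux)
  have sub: "set (cart_segments m c) \<subseteq> set (segments m c)"
       "set (iface_segments m c) \<subseteq> set (segments m c)"
    by (auto simp: cart_segments_def iface_segments_def)

  have C: "?C e - ?g (scaled_normal e) \<in> span {advected v}" if e: "e \<in> set (cart_segments m c)" for e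
  proof -
    \<comment> \<open>The two Gauss weights sum to 1, so the linear \<open>?g\<close> splits over
      the nodes.\<close>
    have "?C e - ?g (scaled_normal e)
        = (\<Sum>k\<in>{1, 2}. (seg_length e * gauss_weight k) *\<^sub>R (?Fs e k - ?g (seg_normal e)))"
      unfolding scaled_normal_def linear_scale[OF g]
      by (simp add: gauss_weight_def vec_eq_iff field_simps)
    also have "\<dots> \<in> span {advected v}"
    proof (intro span_sum span_mul flux_single_equilibrium gam)
      fix k :: nat assume "k \<in> {1, 2}"
      \<comment> \<open>Across a Cartesian edge the material is the same, so the exterior state is
        an equilibrium state for \<open>?q\<close> too.\<close>
      with e sub cart int[of e k] ext[of e k]
      show "U_int R U M c e k \<in> equilibrium_set v p ?q" "U_ext R U M e k \<in> equilibrium_set v p ?q"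
        by auto
    qed
    finally show ?thesis .
  qed

  \<comment> \<open>The two materials may differ, but each side has pressure \<open>p\<close> under
    its own equation of state, and the normal is a unit vector as \<open>equilibrium_exact\<close>
    demands.\<close>
  have rs: "rs ?q (q (material_of m (nbr e))) (seg_normal e) (U_int R U M c e k) (U_ext R U M e k)
      = (p, v \<bullet> seg_normal e)"
    if "e \<in> set (iface_segments m c)" "k \<in> {1, 2}" for e k
  proof -
    have "e \<in> set (segments m c)"
      using that sub by blast
    then show ?thesis
      using int[of e k] ext[of e k] that nondeg riemann
      by (simp add: mem_equilibrium_set_iff gam norm_seg_normal equilibrium_exact_def)
  qed

  have "(\<Sum>e\<leftarrow>iface_segments m c. \<Sum>k\<in>{1, 2}. (seg_length e * gauss_weight k) *\<^sub>R
          flux_multi rs ?q (q (material_of m (nbr e))) (seg_normal e)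
            (U_int R U M c e k) (U_ext R U M e k))
      = (\<Sum>e\<leftarrow>iface_segments m c. p *\<^sub>R pressure_flux v (scaled_normal e))"
  proof (intro arg_cong[where f = sum_list] map_cong refl)
    fix e assume "e \<in> set (iface_segments m c)"
    then have "(\<Sum>k\<in>{1, 2}. (seg_length e * gauss_weight k) *\<^sub>R
          flux_multi rs ?q (q (material_of m (nbr e))) (seg_normal e)
            (U_int R U M c e k) (U_ext R U M e k))
        = (\<Sum>k\<in>{1, 2::nat}. (seg_length e * gauss_weight k) *\<^sub>R p *\<^sub>R pressure_flux v (seg_normal e))"
      by (intro sum.cong refl) (subst flux_multi_equilibrium, erule (1) rs, rule refl)
    also have "\<dots> = p *\<^sub>R pressure_flux v (scaled_normal e)"
      unfolding scaled_normal_def linear_scale[OF P]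
      by (simp add: gauss_weight_def vec_eq_iff)
    finally show "(\<Sum>k\<in>{1, 2}. (seg_length e * gauss_weight k) *\<^sub>R
          flux_multi rs ?q (q (material_of m (nbr e))) (seg_normal e)
            (U_int R U M c e k) (U_ext R U M e k)) = p *\<^sub>R pressure_flux v (scaled_normal e)" .
  qed
  then have total: "total_op q m R rs U M c
      = - (\<Sum>e\<leftarrow>cart_segments m c. ?C e)
        - (\<Sum>e\<leftarrow>iface_segments m c. p *\<^sub>R pressure_flux v (scaled_normal e))"
    by (simp only: total_op_def)

  \<comment> \<open>For \<open>s = r = 0\<close> the monomials equal 1, leaving the flux of the
    constant field \<open>v\<close> through the interface edges.\<close>
  have moment: "moment_op q m R rs U M c 0 0 = (\<Sum>e\<leftarrow>iface_segments m c. v \<bullet> scaled_normal e)"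
    unfolding moment_op_def
    by (intro arg_cong[where f = sum_list] map_cong refl)
       (simp add: v_perp_def rs gauss_weight_def scaled_normal_def)

  have "(\<Sum>e\<leftarrow>segments m c. ?g (scaled_normal e)) = 0"
    using loops by (simp only: sum_list_linear[OF g] segments_def sum_scaled_normal_boundary linear_0[OF g])
  then have "(\<Sum>e\<leftarrow>cart_segments m c. ?g (scaled_normal e))
      = - (\<Sum>e\<leftarrow>iface_segments m c. ?g (scaled_normal e))"
    by (simp only: sum_list_segments_split add_eq_0_iff2)
  also have "\<dots> = - moment_op q m R rs U M c 0 0 *\<^sub>R ?b
      - (\<Sum>e\<leftarrow>iface_segments m c. p *\<^sub>R pressure_flux v (scaled_normal e))"
    using sum_list_linear[of "\<lambda>t. t *\<^sub>R ?b" "\<lambda>e. v \<bullet> scaled_normal e" "iface_segments m c"]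
    by (simp add: sum_list_addf moment linear_scale_left)
  \<comment> \<open>The moment term and the interface pressure terms together make up the Cartesian
    sum of \<open>?g\<close>, so only the edgewise differences from \<open>C\<close>
    survive.\<close>
  finally have "total_op q m R rs U M c - moment_op q m R rs U M c 0 0 *\<^sub>R ?b
      = - (\<Sum>e\<leftarrow>cart_segments m c. ?C e - ?g (scaled_normal e))"
    by (simp only: total sum_list_subtractf) (simp add: algebra_simps)
  also have "\<dots> \<in> span {advected v}"
    by (intro span_neg sum_list_in_subspace C) simp_all
  finally show ?thesis .
qed

section \<open>The forward Euler step\<close>

theorem theorem3p6:
  fixes q :: "material \<Rightarrow> eos"
    and m :: "'c mesh"
    and S :: "'c \<Rightarrow> 'c set"
    and R :: "'c reconstruction"
    and rs :: riemann_solver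
    and U0 U1 :: "'c totals"
    and M0 M1 :: "'c moments"
    and dt p :: real
    and v :: "real^2"
  assumes gam: "\<And>a. 1 < gam (q a)"
    and Bc: "\<And>a. 0 \<le> Bc (q a)"
    and mesh: "cut_cell_mesh m"
    and stencils: "single_material_stencils m S R"
    and EC: "equilibrium_compatible q m S R"
    and riemann: "equilibrium_exact q rs"
    and dt: "0 < dt"
    and size_pos: "\<And>c. 0 < M0 c 0 0"
    and trace_pos: "\<And>c x. (c, x) \<in> trace_points m \<Longrightarrow> 0 < mass_density (R U0 M0 c x)"
    and equilibrium: "\<And>c. average U0 M0 c \<in> equilibrium_set v p (q (material_of m c))"
    and step_M: "\<And>c s r. c \<in> cvs m \<Longrightarrow> M1 c s r = M0 c s r + dt * moment_op q m R rs U0 M0 c s r"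
    and step_U: "\<And>c. c \<in> cvs m \<Longrightarrow> U1 c = U0 c + dt *\<^sub>R total_op q m R rs U0 M0 c"
  shows "\<forall>c \<in> cvs m. 0 < M1 c 0 0 \<longrightarrow> 0 < mass_density (average U1 M1 c) \<longrightarrow>
           average U1 M1 c \<in> equilibrium_set v p (q (material_of m c))"
proof (intro ballI impI)
  fix c assume c: "c \<in> cvs m" and M1: "0 < M1 c 0 0"
    and dens: "0 < mass_density (average U1 M1 c)"
  let ?b = "internal p (q (material_of m c))"
  have cell: "polygonal_cell (region m c) (loops m c)"
    using mesh c by (simp add: cut_cell_mesh_def)
  have trace: "R U0 M0 d (gauss_point e k) \<in> equilibrium_set v p (q (material_of m d))"
    if "e \<in> set (segments m c)" "k \<in> {1, 2}" "d = c \<or> d = nbr e" for d e k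
  proof -
    have "(d, gauss_point e k) \<in> trace_points m"
      unfolding trace_points_def using c that by blast
    then show ?thesis
      by (intro reconstruction_equilibrium[OF gam EC size_pos equilibrium] trace_pos)
  qed
  have "total_op q m R rs U0 M0 c - moment_op q m R rs U0 M0 c 0 0 *\<^sub>R ?b \<in> span {advected v}"
  proof (rule total_op_equilibrium[OF gam riemann])
    show "\<forall>es \<in> set (loops m c). closed_loop es"
      using cell by (simp add: polygonal_cell_def)
    show "\<forall>e \<in> set (segments m c). seg_start e \<noteq> seg_end e"
      using cell by (simp add: polygonal_cell_def segments_def)
    show "\<forall>e \<in> set (cart_segments m c). material_of m (nbr e) = material_of m c"
      using mesh c by (simp add: cut_cell_mesh_def)
  qed (simp_all add: U_int_def U_ext_def trace)
  \<comment> \<open>Here \<open>\<phi>\<close> is the rate of change of the mass of the cell, since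
    \<open>advected v\<close> has first component 1 and \<open>?b\<close> has 0.\<close>
  then obtain \<phi> where \<phi>:
    "total_op q m R rs U0 M0 c = moment_op q m R rs U0 M0 c 0 0 *\<^sub>R ?b + \<phi> *\<^sub>R advected v"
    unfolding span_singleton by (metis (no_types, lifting) add.commute diff_eq_eq rangeE)
  obtain \<rho> where "average U0 M0 c = \<rho> *\<^sub>R advected v + ?b"
    using equilibrium[of c] by (auto simp: equilibrium_set_eq_ray)
  moreover have "U0 c = M0 c 0 0 *\<^sub>R average U0 M0 c"
    using size_pos[of c] by (simp add: average_def)
  \<comment> \<open>The coefficient of \<open>?b\<close> is the old cell size plus \<open>dt\<close>
    times its rate, which is \<open>M1 c 0 0\<close> by \<open>step_M\<close>; this is where both
    updates must use the same step.\<close>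
  ultimately have "U1 c = (M0 c 0 0 * \<rho> + dt * \<phi>) *\<^sub>R advected v + M1 c 0 0 *\<^sub>R ?b"
    using c by (simp add: step_U step_M \<phi> algebra_simps)
  then have avg: "average U1 M1 c = ((M0 c 0 0 * \<rho> + dt * \<phi>) / M1 c 0 0) *\<^sub>R advected v + ?b"
    using M1 by (simp add: average_def scaleR_add_right divide_inverse mult.commute)
  \<comment> \<open>The parameter along the ray is the density itself, so \<open>dens\<close> puts
    the new average on the positive part.\<close>
  then have "mass_density (average U1 M1 c) = (M0 c 0 0 * \<rho> + dt * \<phi>) / M1 c 0 0"
    by (simp add: mass_density_def advected_def internal_def)
  with avg dens show "average U1 M1 c \<in> equilibrium_set v p (q (material_of m c))"
    unfolding equilibrium_set_eq_ray by auto
qed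

end
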